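(* Let $m\ge 2$ and $n\ge 1$ be integers. The critical group of the de Bruijn graph $DB_n(m)$ is \[K(DB_n(m))\cong(\mathbb{Z}_{m^n})^{m-2}\oplus\bigoplus_{i=1}^{n-1}(\mathbb{Z}_{m^i})^{m^{n-1-i}(m-1)^2}.\]
   Context: The de Bruijn graph $DB_n(m)$ is the directed graph whose vertices are the strings of length $n$ over an alphabet of $m$ symbols and whose edges are the strings $s_0s_1\ldots s_n$ of length $n+1$, the edge $s_0\ldots s_n$ going from $s_0\ldots s_{n-1}$ to $s_1\ldots s_n$ (loops allowed). Thus $DB_1(m)$ is the complete directed graph on $m$ vertices with a loop at each vertex, and $DB_{n+1}(m)$ is the directed line graph of $DB_n(m)$. For a finite strongly connected directed graph $G=(V,E)$ with $\mathrm{indeg}(v)=\mathrm{outdeg}(v)$ for all $v$ (Eulerian), let $\mathbb{Z}^V$ be the free abelian group on $V$, set $\Delta_v=\sum_{e\in E:\ s(e)=v}(t(e)-v)$, and for $r\in V$ define $K(G,r)=\mathbb{Z}^V/\langle r,\ \Delta_v : v\in V\setminus\{r\}\rangle$; for Eulerian $G$ these groups are isomorphic for all $r$, and the common group is the critical group $K(G)$. $\mathbb{Z}_k$ denotes the cyclic group of order $k$. *)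

theory Defs
  imports
    "HOL-Algebra.Elementary_Groups"
    "HOL-Algebra.Free_Abelian_Groups"
    "Graph_Theory.Digraph"
begin

definition strings :: "nat \<Rightarrow> nat \<Rightarrow> nat list set" where
  "strings m n = {w. set w \<subseteq> {..<m} \<and> length w = n}"

definition de_Bruijn :: "nat \<Rightarrow> nat \<Rightarrow> (nat list, nat list) pre_digraph" where
  "de_Bruijn n m =
     \<lparr>verts = strings m n, arcs = strings m (Suc n), tail = butlast, head = tl\<rparr>"

definition laplacian :: "('a, 'b) pre_digraph \<Rightarrow> 'a \<Rightarrow> ('a \<Rightarrow>\<^sub>0 int)" where
  "laplacian G v = (\<Sum>e\<in>out_arcs G v. frag_of (head G e) - frag_of v)"

text \<open>
  The group \<open>K(G, r)\<close>. It is meaningful for finite \<open>G\<close>; if \<open>G\<close> is moreover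
  strongly connected and Eulerian, its isomorphism type does not depend on the vertex \<open>r\<close>
  and is the critical group \<open>K(G)\<close>. A statement about \<open>K(G)\<close> is therefore
  made for every choice of \<open>r\<close>.
\<close>
definition critical_group :: "('a, 'b) pre_digraph \<Rightarrow> 'a \<Rightarrow> ('a \<Rightarrow>\<^sub>0 int) set monoid" where
  "critical_group G r =
     free_Abelian_group (verts G) Mod
     generate (free_Abelian_group (verts G))
       (insert (frag_of r) (laplacian G ` (verts G - {r})))"

definition group_power :: "('a, 'b) monoid_scheme \<Rightarrow> nat \<Rightarrow> (nat \<Rightarrow> 'a) monoid" where
  "group_power G k = product_group {..<k} (\<lambda>_. G)"

end

theory Submission
  imports Defs
begin

text \<open>
  For a nonempty word \<open>q\<close> of length at most \<open>n\<close> with nonzero first letter, let \<open>E(q)\<close> be the difference of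
  the vertices obtained by padding \<open>q\<close>, and \<open>q\<close> with its first letter set to \<open>0\<close>, by zeros on the
  left. Since \<open>m v = (\<Sum>a. (tl v) a)\<close> depends on \<open>tl v\<close> only, the critical group is generated by the
  \<open>E(q)\<close>, with relations \<open>m E(q) = (\<Sum>a. E(q a))\<close> if \<open>q\<close> is shorter than \<open>n\<close>, \<open>m E(q) = 0\<close> if \<open>q\<close> has
  length \<open>n\<close>, and \<open>(\<Sum>a \<noteq> 0. E(a)) = 0\<close>. The first relation eliminates the \<open>E(q)\<close> with last letter \<open>0\<close>
  and the last one eliminates \<open>E(1)\<close>. The remaining generators are independent, and \<open>E(q)\<close> has order
  \<open>m\<close> to the power \<open>n + 1 - length q\<close>.
\<close>

section \<open>Eliminated generators and their coordinates\<close>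

text \<open>
  The coefficient of \<open>E(p)\<close> when \<open>E(q)\<close> is rewritten in the remaining generators. The defining
  equations are those of the elimination, so \<open>m E(q) = (\<Sum>a. E(q a))\<close> holds over the integers for
  \<open>q\<close> of any length, and only \<open>m E(q) = 0\<close> for \<open>q\<close> of length \<open>n\<close> needs the moduli.
\<close>
fun coord :: "nat \<Rightarrow> nat list \<Rightarrow> nat list \<Rightarrow> int" where
  "coord m q p =
     (if length q \<le> 1 then of_bool (q = p) - of_bool (q = [1] \<and> length p = 1)
      else if last q \<noteq> 0 then of_bool (q = p)
      else int m * coord m (butlast q) p - of_bool (butlast p = butlast q))"

declare coord.simps [simp del]

text \<open>Changing the nonzero letters of a vertex to \<open>0\<close> from left to right
  telescopes its difference from the zero word into the \<open>E(q)\<close> with \<open>q\<close> a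
  suffix whose first letter is nonzero. This is the \<open>p\<close>-coordinate of that sum; leading
  zeros contribute nothing.\<close>

primrec word_coord :: "nat \<Rightarrow> nat list \<Rightarrow> nat list \<Rightarrow> int" where
  "word_coord m [] p = 0"
| "word_coord m (c # w) p = (if c = 0 then 0 else coord m (c # w) p) + word_coord m w p"

text \<open>The indices of the generators that survive: a final \<open>0\<close> is eliminated by
  the relation of the word without it, and \<open>[1]\<close> by the relation at the zero
  vertex.\<close>

definition stems :: "nat \<Rightarrow> nat \<Rightarrow> nat list set" where
  "stems m k = {p \<in> strings m k. p \<noteq> [] \<and> hd p \<noteq> 0 \<and> last p \<noteq> 0 \<and> p \<noteq> [1]}"

text \<open>This is \<open>E(q)\<close>: the extra zero in the second padding stands in for the
  first letter of \<open>q\<close>.\<close>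

definition stem_frag :: "nat \<Rightarrow> nat list \<Rightarrow> (nat list \<Rightarrow>\<^sub>0 int)" where
  "stem_frag n q = frag_of (replicate (n - length q) 0 @ q)
     - frag_of (replicate (Suc n - length q) 0 @ tl q)"

section \<open>Counting the stems of each length\<close>

lemma finite_strings [simp]: "finite (strings m n)"
  unfolding strings_def by (rule finite_lists_length_eq) simp

lemma card_strings: "card (strings m n) = m ^ n"
  unfolding strings_def by (simp add: card_lists_length_eq)

lemma finite_stems [simp]: "finite (stems m k)"
  by (simp add: stems_def)

lemma stems_one: "stems m 1 = (\<lambda>c. [c]) ` {2..<m}"
proof -
  have "p \<in> (\<lambda>c. [c]) ` {2..<m}" if "p \<in> stems m 1" for p
    using that by (cases p) (auto simp: stems_def strings_def image_iff)
  then show ?thesis by (auto simp: stems_def strings_def)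
qed

lemma card_stems_one: "card (stems m 1) = m - 2"
  unfolding stems_one by (subst card_image) (auto simp: inj_on_def)

text \<open>From length two on, the first and last letters are separate and nonzero, the middle is
  free, and the exclusion of \<open>[1]\<close> is automatic.\<close>

lemma card_stems_Suc_Suc: "card (stems m (Suc (Suc j))) = m ^ j * (m - 1)^2"
proof -
  let ?f = "\<lambda>(c, w, b). c # w @ [b]"
  have "p \<in> ?f ` ({1..<m} \<times> strings m j \<times> {1..<m})" if p: "p \<in> stems m (Suc (Suc j))" for p
  proof -
    obtain c w b where "p = c # w @ [b]"
      using p by (cases p; cases "tl p" rule: rev_cases) (auto simp: stems_def strings_def)
    then show ?thesis
      using p by (auto simp: stems_def strings_def image_iff)
  qed
  then have "stems m (Suc (Suc j)) = ?f ` ({1..<m} \<times> strings m j \<times> {1..<m})"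
    by (auto simp: stems_def strings_def)
  moreover have "inj_on ?f ({1..<m} \<times> strings m j \<times> {1..<m})"
    by (auto simp: inj_on_def)
  ultimately show ?thesis
    by (simp add: card_image card_cartesian_product card_strings power2_eq_square)
qed

section \<open>The relations in coordinates, and divisibility\<close>

lemma coord_snoc:
  assumes "q \<noteq> []"
  shows "coord m (q @ [a]) p =
    (if a \<noteq> 0 then of_bool (q @ [a] = p) else int m * coord m q p - of_bool (butlast p = q))"
  using assms by (subst coord.simps) (auto simp: Suc_le_eq)

lemma coord_single: "coord m [a] p = of_bool ([a] = p) - of_bool (a = 1 \<and> length p = 1)"
  by (subst coord.simps) auto

lemma coord_stem:
  assumes "p \<in> stems m k" "q \<in> stems m l"
  shows "coord m q p = of_bool (q = p)"
  using assms by (cases q rule: rev_cases; cases "butlast q = []") (auto simp: coord_snoc coord_single stems_def)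

lemma lessThan_insert_zero: "0 < m \<Longrightarrow> {..<m::nat} = insert 0 {1..<m}"
  by auto

text \<open>A stem ends in a nonzero letter, so the terms with \<open>a \<noteq> 0\<close> add up to
  the indicator of \<open>butlast p = q\<close>, which is exactly what the coordinate of
  \<open>q @ [0]\<close> subtracts.\<close>

lemma sum_coord_snoc:
  assumes "p \<in> stems m k" "q \<noteq> []" "0 < m"
  shows "(\<Sum>a<m. coord m (q @ [a]) p) = int m * coord m q p"
proof -
  have p: "p \<noteq> []" "last p \<in> {1..<m}"
    using assms last_in_set[of p] by (auto simp: stems_def strings_def subset_iff)
  have "(\<Sum>a\<in>{1..<m}. coord m (q @ [a]) p) = (\<Sum>a\<in>{1..<m}. if last p = a then of_bool (butlast p = q) else 0)"
  proof (intro sum.cong refl)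
    fix a assume a: "a \<in> {1..<m}"
    have "q @ [a] = p \<longleftrightarrow> last p = a \<and> butlast p = q"
      using append_butlast_last_id[OF p(1)] by auto
    then show "coord m (q @ [a]) p = (if last p = a then of_bool (butlast p = q) else 0)"
      using a assms(2) by (simp add: coord_snoc)
  qed
  also have "\<dots> = of_bool (butlast p = q)"
    using p by (subst sum.delta') auto
  finally show ?thesis
    using coord_snoc[OF assms(2), of m 0 p] assms(3) by (simp add: lessThan_insert_zero)
qed

text \<open>For \<open>p = [d]\<close> the contribution 1 at \<open>a = d\<close> is cancelled by
  the correction -1 at \<open>a = 1\<close>. This is the relation at the zero vertex.\<close>

lemma sum_coord_single:
  assumes "p \<in> stems m k"
  shows "(\<Sum>a\<in>{1..<m}. coord m [a] p) = 0"
proof (cases "length p = 1")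
  case True
  then obtain d where p: "p = [d]" by (cases p) auto
  have d: "d \<in> {1..<m}" "d \<noteq> 1" using assms p by (auto simp: stems_def strings_def)
  then show ?thesis
    by (auto simp: coord_single p sum_subtractf sum.delta of_bool_def cong: if_cong)
next
  case False
  then have "coord m [a] p = 0" for a by (auto simp: coord_single)
  then show ?thesis by simp
qed

text \<open>The nonempty suffixes of \<open>w @ [a]\<close> are the nonempty suffixes of
  \<open>w\<close> extended by \<open>a\<close>, which yield the factor \<open>m\<close>, and
  \<open>[a]\<close> itself, whose sum over \<open>a\<close> vanishes.\<close>

lemma sum_word_coord_snoc:
  assumes "p \<in> stems m k" "0 < m"
  shows "(\<Sum>a<m. word_coord m (w @ [a]) p) = int m * word_coord m w p"
proof (induction w)
  case Nil
  then show ?case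
    using sum_coord_single[OF assms(1)] by (simp add: lessThan_insert_zero[OF assms(2)])
next
  case (Cons c w)
  then show ?case
    using sum_coord_snoc[OF assms(1), of "c # w"] assms
    by (auto simp: sum.distrib algebra_simps)
qed

lemma word_coord_zeros [simp]: "word_coord m (replicate k 0 @ w) p = word_coord m w p"
  by (induction k) auto

text \<open>Eliminating a final \<open>0\<close> multiplies the coordinate by \<open>m\<close> for
  each letter of \<open>q\<close> beyond the length of \<open>p\<close>; the indicator terms occur
  only at equal lengths. Multiplying by a power of \<open>m\<close> avoids a difference of
  exponents.\<close>

lemma power_dvd_coord_mult_power:
  assumes "q \<noteq> []" "p \<noteq> []" "length p \<le> length q"
  shows "int m ^ length q dvd coord m q p * int m ^ length p"
  using assms
proof (induction q rule: rev_induct)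
  case (snoc b q)
  show ?case
  proof (cases "q = []")
    case True
    then show ?thesis using snoc.prems by (intro dvd_mult) (auto simp: le_imp_power_dvd Suc_le_eq)
  next
    case False
    have "int m ^ length (q @ [b]) dvd int m * coord m q p * int m ^ length p"
    proof (cases "length p \<le> length q")
      case True
      then show ?thesis using snoc False by (simp add: mult.assoc)
    next
      case False
      then have "length p = length (q @ [b])" using snoc.prems by simp
      then show ?thesis by (metis dvd_triv_right)
    qed
    moreover have "int m ^ length (q @ [b]) dvd of_bool (butlast p = q) * int m ^ length p"
    proof (cases "butlast p = q")
      case True
      then have "length p = length (q @ [b])"
        using snoc.prems by (auto simp: Suc_diff_1)
      then show ?thesis by (metis dvd_triv_right)
    qed simp
    moreover have "int m ^ length (q @ [b]) dvd of_bool (q @ [b] = p) * int m ^ length p"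
      by auto
    ultimately show ?thesis
      using False by (auto simp: coord_snoc left_diff_distrib intro: dvd_diff)
  qed
qed auto

text \<open>The remaining relation \<open>m E(q) = 0\<close> for \<open>q\<close> of full length,
  read modulo the order of \<open>E(p)\<close>: multiply the preceding divisibility by
  \<open>m\<close> and cancel \<open>int m ^ k\<close>.\<close>

lemma modulus_dvd_mult_coord:
  assumes "p \<in> stems m k" "k \<le> n" "length q = n" "0 < m" "0 < n"
  shows "int m ^ (Suc n - k) dvd int m * coord m q p"
proof -
  have p: "length p = k" "p \<noteq> []" using assms by (auto simp: stems_def strings_def)
  have "int m ^ n dvd coord m q p * int m ^ k"
    using power_dvd_coord_mult_power[of q p m] assms p by auto
  then have "int m * int m ^ n dvd int m * (coord m q p * int m ^ k)"
    by (rule mult_dvd_mono[OF dvd_refl])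
  also have "int m * int m ^ n = int m ^ (Suc n - k) * int m ^ k"
    using assms by (simp flip: power_add)
  finally show ?thesis
    using assms by (simp flip: mult.assoc)
qed

section \<open>Laplacians, and subgroups of a free abelian group\<close>

lemma frag_cmul_diff_right: "frag_cmul c (x - y) = frag_cmul c x - frag_cmul c y"
  by (rule poly_mapping_eqI) (simp add: lookup_minus right_diff_distrib)

lemma sum_const_frag: "(\<Sum>a<k. x) = frag_cmul (int k) x" for k :: nat
  by (induction k) (auto simp: frag_cmul_distrib algebra_simps)

lemma laplacian_de_Bruijn:
  assumes "v \<in> strings m n" "0 < n"
  shows "laplacian (de_Bruijn n m) v
    = (\<Sum>a<m. frag_of (tl v @ [a])) - frag_cmul (int m) (frag_of v)"
proof -
  have v: "v \<noteq> []" using assms by (auto simp: strings_def)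
  have "e \<in> (\<lambda>a. v @ [a]) ` {..<m}" if "e \<in> out_arcs (de_Bruijn n m) v" for e
    using that by (cases e rule: rev_cases) (auto simp: out_arcs_def de_Bruijn_def strings_def)
  then have arcs: "out_arcs (de_Bruijn n m) v = (\<lambda>a. v @ [a]) ` {..<m}"
    using assms by (auto simp: out_arcs_def de_Bruijn_def strings_def)
  have "laplacian (de_Bruijn n m) v = (\<Sum>a<m. frag_of (tl v @ [a]) - frag_of v)"
    unfolding laplacian_def arcs by (subst sum.reindex) (auto simp: inj_on_def de_Bruijn_def v)
  then show ?thesis by (simp add: sum_subtractf sum_const_frag)
qed

text \<open>In-degree equals out-degree: \<open>u @ [a]\<close> is a successor of exactly the
  \<open>m\<close> words \<open>c # u\<close>. Splitting words at the front enumerates the sources,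
  splitting them at the rear the targets.\<close>

lemma sum_laplacian_de_Bruijn:
  assumes "0 < n"
  shows "(\<Sum>v\<in>strings m n. laplacian (de_Bruijn n m) v) = 0"
proof -
  obtain k where n: "n = Suc k" using assms by (cases n) auto
  have front: "strings m n = (\<lambda>(u, c). c # u) ` (strings m k \<times> {..<m})"
  proof -
    have "v \<in> (\<lambda>(u, c). c # u) ` (strings m k \<times> {..<m})" if "v \<in> strings m n" for v
      using that n by (cases v) (auto simp: strings_def image_iff)
    then show ?thesis by (auto simp: strings_def n)
  qed
  have rear: "strings m n = (\<lambda>(u, c). u @ [c]) ` (strings m k \<times> {..<m})"
  proof -
    have "v \<in> (\<lambda>(u, c). u @ [c]) ` (strings m k \<times> {..<m})" if "v \<in> strings m n" for v
      using that n by (cases v rule: rev_cases) (auto simp: strings_def image_iff)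
    then show ?thesis by (auto simp: strings_def n)
  qed
  have "(\<Sum>v\<in>strings m n. \<Sum>a<m. frag_of (tl v @ [a]))
      = (\<Sum>(u, c)\<in>strings m k \<times> {..<m}. \<Sum>a<m. frag_of (u @ [a]))"
    unfolding front by (subst sum.reindex) (auto simp: inj_on_def intro!: sum.cong)
  also have "\<dots> = frag_cmul (int m) (\<Sum>(u, a)\<in>strings m k \<times> {..<m}. frag_of (u @ [a]))"
    by (simp add: sum_const_frag frag_cmul_sum flip: sum.cartesian_product)
  also have "(\<Sum>(u, a)\<in>strings m k \<times> {..<m}. frag_of (u @ [a])) = (\<Sum>v\<in>strings m n. frag_of v)"
    unfolding rear by (subst sum.reindex) (auto simp: inj_on_def intro!: sum.cong)
  finally show ?thesis
    using assms by (simp add: laplacian_de_Bruijn sum_subtractf frag_cmul_sum cong: sum.cong)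
qed

text \<open>Subgroups in additive notation, so that membership can be derived by arithmetic on
  formal sums; used both for generated subgroups and for sets given by a property.\<close>

locale frag_subgroup =
  fixes A :: "('a \<Rightarrow>\<^sub>0 int) set"
  assumes zero_closed: "0 \<in> A"
    and diff_closed: "x \<in> A \<Longrightarrow> y \<in> A \<Longrightarrow> x - y \<in> A"
begin

lemma uminus_closed: "x \<in> A \<Longrightarrow> - x \<in> A"
  using diff_closed[OF zero_closed] by fastforce

lemma add_closed: "x \<in> A \<Longrightarrow> y \<in> A \<Longrightarrow> x + y \<in> A"
  using diff_closed[OF _ uminus_closed] by fastforce

lemma cmul_closed:
  assumes "x \<in> A"
  shows "frag_cmul c x \<in> A"
proof -
  have nat: "frag_cmul (int k) x \<in> A" for k
    by (induction k) (auto simp: zero_closed frag_cmul_distrib intro: add_closed assms)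
  show ?thesis
  proof (cases "0 \<le> c")
    case True
    then show ?thesis using nat[of "nat c"] by simp
  next
    case False
    then show ?thesis using uminus_closed[OF nat[of "nat (- c)"]] by simp
  qed
qed

lemma sum_closed: "(\<And>i. i \<in> I \<Longrightarrow> f i \<in> A) \<Longrightarrow> sum f I \<in> A"
  by (induction I rule: infinite_finite_induct) (auto simp: zero_closed intro: add_closed)

end

lemma frag_subgroup_generate:
  assumes "S \<subseteq> carrier (free_Abelian_group V)"
  shows "frag_subgroup (generate (free_Abelian_group V) S)"
proof
  have sub: "subgroup (generate (free_Abelian_group V) S) (free_Abelian_group V)"
    by (rule group.generate_is_subgroup[OF group_free_Abelian_group assms])
  show "0 \<in> generate (free_Abelian_group V) S"
    using subgroup.one_closed[OF sub] by simp
  fix x y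
  assume xy: "x \<in> generate (free_Abelian_group V) S" "y \<in> generate (free_Abelian_group V) S"
  then have "y \<in> carrier (free_Abelian_group V)"
    using subgroup.subset[OF sub] by blast
  then show "x - y \<in> generate (free_Abelian_group V) S"
    using subgroup.m_closed[OF sub xy(1) subgroup.m_inv_closed[OF sub xy(2)]] by simp
qed

lemma (in frag_subgroup) free_Abelian_group_subset:
  assumes "\<And>v. v \<in> V \<Longrightarrow> frag_of v \<in> A" "Poly_Mapping.keys x \<subseteq> V"
  shows "x \<in> A"
  by (rule free_Abelian_group_induct[OF assms(2)]) (auto intro: zero_closed diff_closed assms(1))

section \<open>Relations among the \<open>E(q)\<close> and generation by stems\<close>

text \<open>
  The relation \<open>m E(q) = (\<Sum>a<m. E(q a))\<close> is a difference of two Laplacian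
  relations, because \<open>q\<close> padded to length \<open>n\<close> starts with \<open>0\<close>.
\<close>
lemma cmul_stem_frag:
  assumes "q \<noteq> []" "set q \<subseteq> {..<m}" "length q < n"
  shows "frag_cmul (int m) (stem_frag n q) - (\<Sum>a<m. stem_frag n (q @ [a]))
    = laplacian (de_Bruijn n m) (replicate (Suc n - length q) 0 @ tl q)
      - laplacian (de_Bruijn n m) (replicate (n - length q) 0 @ q)"
proof -
  obtain k where k: "n = Suc k + length q"
    using assms by (metis add.commute add_Suc_right less_iff_Suc_add)
  obtain c w where q: "q = c # w" using assms(1) by (cases q) auto
  have str: "replicate (Suc n - length q) 0 @ tl q \<in> strings m n"
    "replicate (n - length q) 0 @ q \<in> strings m n"
    using assms k q by (auto simp: strings_def)
  have n: "0 < n" using k by simp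
  show ?thesis
    unfolding laplacian_de_Bruijn[OF str(1) n] laplacian_de_Bruijn[OF str(2) n] stem_frag_def
    using k q by (simp del: minus_frag_cmul add: sum_subtractf frag_cmul_diff_right Suc_diff_le)
qed

text \<open>The vertices \<open>q\<close> and \<open>0 # tl q\<close> have the same successors, so
  these cancel in the difference of the Laplacians.\<close>

lemma cmul_stem_frag_full:
  assumes "q \<noteq> []" "set q \<subseteq> {..<m}" "length q = n"
  shows "frag_cmul (int m) (stem_frag n q)
    = laplacian (de_Bruijn n m) (0 # tl q) - laplacian (de_Bruijn n m) q"
proof -
  obtain c w where q: "q = c # w" using assms(1) by (cases q) auto
  have str: "0 # tl q \<in> strings m n" "q \<in> strings m n"
    using assms q by (auto simp: strings_def)
  have n: "0 < n" using assms by auto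
  show ?thesis
    unfolding laplacian_de_Bruijn[OF str(1) n] laplacian_de_Bruijn[OF str(2) n] stem_frag_def
    using assms q by (auto simp del: minus_frag_cmul simp: frag_cmul_diff_right)
qed

text \<open>The successors of the zero word are the paddings of the single letters; the loop
  \<open>a = 0\<close> contributes zero.\<close>

lemma sum_stem_frag_single:
  assumes "0 < m" "0 < n"
  shows "(\<Sum>a\<in>{1..<m}. stem_frag n [a]) = laplacian (de_Bruijn n m) (replicate n 0)"
proof -
  have str: "replicate n 0 \<in> strings m n" using assms by (auto simp: strings_def)
  obtain k where n: "n = Suc k" using assms by (cases n) auto
  have rep: "replicate k 0 @ [0::nat] = replicate (Suc k) 0"
    by (simp add: replicate_append_same)
  have "(\<Sum>a\<in>{1..<m}. stem_frag n [a]) = (\<Sum>a<m. stem_frag n [a])"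
    using assms rep by (simp add: lessThan_insert_zero stem_frag_def n)
  also have "\<dots> = laplacian (de_Bruijn n m) (replicate n 0)"
    using laplacian_de_Bruijn[OF str assms(2)]
    by (simp add: stem_frag_def sum_subtractf sum_const_frag n)
  finally show ?thesis .
qed

text \<open>Working modulo \<open>A\<close> makes all Laplacians vanish, including the one at the
  root. \<open>A\<close> will be the relation subgroup, and later a larger subgroup shown to be
  everything.\<close>

locale laplacian_subgroup = frag_subgroup A for A :: "(nat list \<Rightarrow>\<^sub>0 int) set" +
  fixes m n :: nat
  assumes m_pos: "0 < m" and n_pos: "0 < n"
    and laplacian_mem: "v \<in> strings m n \<Longrightarrow> laplacian (de_Bruijn n m) v \<in> A"
begin

lemma padded_mem:
  assumes "q \<noteq> []" "set q \<subseteq> {..<m}" "length q \<le> n"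
  shows "replicate (Suc n - length q) 0 @ tl q \<in> strings m n"
    "replicate (n - length q) 0 @ q \<in> strings m n"
  using assms m_pos by (cases q; auto simp: strings_def)+

lemma stem_frag_relation:
  assumes "q \<noteq> []" "set q \<subseteq> {..<m}" "length q < n"
  shows "frag_cmul (int m) (stem_frag n q) - (\<Sum>a<m. stem_frag n (q @ [a])) \<in> A"
  unfolding cmul_stem_frag[OF assms]
  using assms by (intro diff_closed laplacian_mem padded_mem) auto

text \<open>Induction on the number \<open>k\<close> of missing letters: after multiplication by
  \<open>int m ^ Suc k\<close>, the relation for \<open>q\<close> involves only multiples of the
  \<open>E(q a)\<close> that already lie in \<open>A\<close>.\<close>

lemma order_stem_frag:
  assumes "q \<noteq> []" "set q \<subseteq> {..<m}" "length q + k = n"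
  shows "frag_cmul (int m ^ Suc k) (stem_frag n q) \<in> A"
  using assms
proof (induction k arbitrary: q)
  case 0
  then show ?case
    using padded_mem[of q] laplacian_mem[of q] laplacian_mem[of "0 # tl q"]
    by (auto simp: cmul_stem_frag_full intro!: diff_closed)
next
  case (Suc k)
  have "frag_cmul (int m ^ Suc (Suc k)) (stem_frag n q)
    = frag_cmul (int m ^ Suc k) (frag_cmul (int m) (stem_frag n q) - (\<Sum>a<m. stem_frag n (q @ [a])))
      + (\<Sum>a<m. frag_cmul (int m ^ Suc k) (stem_frag n (q @ [a])))"
    by (simp add: frag_cmul_diff_right frag_cmul_sum mult.commute)
  also have "\<dots> \<in> A"
    using Suc by (intro add_closed cmul_closed stem_frag_relation sum_closed Suc.IH) auto
  finally show ?case .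
qed

text \<open>This carries out the elimination, by induction on removing the last letter.\<close>

lemma stem_frag_mem:
  assumes stems: "\<And>k p. k \<in> {1..n} \<Longrightarrow> p \<in> stems m k \<Longrightarrow> stem_frag n p \<in> A"
    and "q \<noteq> []" "hd q \<noteq> 0" "set q \<subseteq> {..<m}" "length q \<le> n"
  shows "stem_frag n q \<in> A"
  using assms(2-)
proof (induction q rule: rev_induct)
  case (snoc b q)
  have stem: "stem_frag n (q @ [a]) \<in> A" if "a \<noteq> 0" "a < m" "q @ [a] \<noteq> [1]" "q = [] \<or> hd q \<noteq> 0" for a
    using that snoc.prems by (intro stems[of "Suc (length q)"]) (cases "q = []"; auto simp: stems_def strings_def)+
  have eq: "x = sum f {..<m} - sum f {1..<m}" if "x = f 0"
    for x :: "nat list \<Rightarrow>\<^sub>0 int" and f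
    using that m_pos by (simp add: lessThan_insert_zero)
  \<comment> \<open>A final \<open>0\<close> is solved from the relation for the shorter word
    \<open>q\<close>, \<open>[1]\<close> from the relation at the zero vertex, and any other word is
    a stem.\<close>
  consider "b = 0" "q \<noteq> []" | "q @ [b] = [1]" | "b \<noteq> 0" "q @ [b] \<noteq> [1]"
    using snoc.prems by (cases "q = []") auto
  then show ?case
  proof cases
    case 1
    have hd: "hd q \<noteq> 0" using 1 snoc.prems by simp
    have "stem_frag n (q @ [b]) = frag_cmul (int m) (stem_frag n q)
        - (frag_cmul (int m) (stem_frag n q) - (\<Sum>a<m. stem_frag n (q @ [a])))
        - (\<Sum>a\<in>{1..<m}. stem_frag n (q @ [a]))"
      using eq[of "stem_frag n (q @ [b])" "\<lambda>a. stem_frag n (q @ [a])"] 1 by simp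
    also have "\<dots> \<in> A"
      using 1 snoc hd by (intro diff_closed cmul_closed stem_frag_relation sum_closed stem) auto
    finally show ?thesis .
  next
    case 2
    then have "1 < m" using snoc.prems by auto
    then have "{1..<m} = insert 1 {2..<m}" by auto
    then have "stem_frag n [1] = (\<Sum>a\<in>{1..<m}. stem_frag n [a]) - (\<Sum>a\<in>{2..<m}. stem_frag n [a])"
      by simp
    also have "\<dots> \<in> A"
      unfolding sum_stem_frag_single[OF m_pos n_pos]
      using 2 m_pos stem by (intro diff_closed laplacian_mem sum_closed) (auto simp: strings_def)
    finally show ?thesis using 2 by simp
  next
    case 3
    then show ?thesis using snoc.prems by (intro stem) (auto simp: hd_append split: if_splits)
  qed
qed simp

text \<open>Telescoping: prepending a nonzero letter \<open>c\<close> to \<open>w\<close> changes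
  the padded vertex by \<open>E(c # w)\<close>, and prepending \<open>0\<close> leaves it
  unchanged.\<close>

lemma frag_of_diff_mem:
  assumes "\<And>k p. k \<in> {1..n} \<Longrightarrow> p \<in> stems m k \<Longrightarrow> stem_frag n p \<in> A"
    and "set w \<subseteq> {..<m}" "length w \<le> n"
  shows "frag_of (replicate (n - length w) 0 @ w) - frag_of (replicate n 0) \<in> A"
  using assms(2-)
proof (induction w)
  case Nil
  then show ?case by (simp add: zero_closed)
next
  case (Cons c w)
  then have IH: "frag_of (replicate (n - length w) 0 @ w) - frag_of (replicate n 0) \<in> A" by simp
  show ?case
  proof (cases "c = 0")
    case True
    have len: "n - length w = Suc (n - length (c # w))"
      using Cons.prems by simp
    have "replicate (n - length (c # w)) 0 @ c # w = replicate (n - length w) 0 @ w"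
      by (simp only: len True replicate_Suc append_Cons replicate_app_Cons_same)
    then show ?thesis using IH by (simp only:)
  next
    case False
    then have "stem_frag n (c # w) \<in> A"
      using Cons.prems stem_frag_mem[OF assms(1), where q = "c # w"] by simp
    from add_closed[OF this IH] show ?thesis by (simp add: stem_frag_def)
  qed
qed

text \<open>All vertices agree with the zero word modulo \<open>A\<close>, hence with
  \<open>r\<close>, which lies in \<open>A\<close>.\<close>

lemma carrier_subset:
  assumes "\<And>k p. k \<in> {1..n} \<Longrightarrow> p \<in> stems m k \<Longrightarrow> stem_frag n p \<in> A"
    and r: "r \<in> strings m n" "frag_of r \<in> A"
    and "Poly_Mapping.keys x \<subseteq> strings m n"
  shows "x \<in> A"
proof (rule free_Abelian_group_subset[OF _ assms(4)])
  fix v assume v: "v \<in> strings m n"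
  have base: "frag_of u - frag_of (replicate n 0) \<in> A" if "u \<in> strings m n" for u
    using frag_of_diff_mem[OF assms(1), where w = u] that by (auto simp: strings_def)
  have "frag_of v = (frag_of v - frag_of (replicate n 0))
      - (frag_of r - frag_of (replicate n 0)) + frag_of r"
    by simp
  also have "\<dots> \<in> A"
    by (intro add_closed diff_closed base v r)
  finally show "frag_of v \<in> A" .
qed

end

section \<open>Coordinates as functionals on formal sums of vertices\<close>

text \<open>
  Subtracting the coordinate of \<open>r\<close> makes the functional vanish at \<open>r\<close> without changing it on
  elements of degree zero, so that every choice of \<open>r\<close> is covered at once.
\<close>
definition functional :: "nat \<Rightarrow> nat \<Rightarrow> nat list \<Rightarrow> nat list \<Rightarrow> (nat list \<Rightarrow>\<^sub>0 int) \<Rightarrow> int" where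
  "functional m n r p x =
    (\<Sum>v\<in>strings m n. Poly_Mapping.lookup x v * (word_coord m v p - word_coord m r p))"

lemma functional_zero [simp]: "functional m n r p 0 = 0"
  by (simp add: functional_def)

lemma functional_add: "functional m n r p (x + y) = functional m n r p x + functional m n r p y"
  by (simp add: functional_def lookup_add distrib_right sum.distrib)

lemma functional_diff: "functional m n r p (x - y) = functional m n r p x - functional m n r p y"
  by (simp add: functional_def lookup_minus left_diff_distrib sum_subtractf)

lemma functional_uminus [simp]: "functional m n r p (- x) = - functional m n r p x"
  by (simp add: functional_def sum_negf)

lemma functional_cmul: "functional m n r p (frag_cmul c x) = c * functional m n r p x"
  by (simp add: functional_def sum_distrib_left mult.assoc)

lemma functional_sum: "functional m n r p (sum f I) = (\<Sum>i\<in>I. functional m n r p (f i))"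
  by (induction I rule: infinite_finite_induct) (auto simp: functional_add)

lemma functional_frag_of:
  assumes "v \<in> strings m n"
  shows "functional m n r p (frag_of v) = word_coord m v p - word_coord m r p"
proof -
  have "functional m n r p (frag_of v)
    = (\<Sum>u\<in>strings m n. if u = v then word_coord m v p - word_coord m r p else 0)"
    unfolding functional_def by (intro sum.cong) auto
  then show ?thesis using assms by simp
qed

text \<open>\<open>E(q)\<close> has degree zero, so the terms at \<open>r\<close> cancel, and the
  two paddings differ by the single suffix \<open>q\<close>. The functionals of the stems are thus
  dual to the stem generators.\<close>

lemma functional_stem_frag:
  assumes "p \<in> stems m k" "q \<in> stems m l" "l \<le> n"
  shows "functional m n r p (stem_frag n q) = of_bool (q = p)"
proof -
  obtain c w where q: "q = c # w" "c \<noteq> 0" using assms by (cases q) (auto simp: stems_def)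
  have "replicate (n - length q) 0 @ q \<in> strings m n" "replicate (Suc n - length q) 0 @ tl q \<in> strings m n"
    using assms q by (auto simp: stems_def strings_def)
  then show ?thesis
    using q coord_stem[OF assms(1,2)]
    by (simp add: stem_frag_def functional_diff functional_frag_of)
qed

text \<open>The successors of \<open>v\<close> sum to \<open>m\<close> times the coordinate of
  \<open>tl v\<close>, so only the suffix \<open>v\<close> itself survives, with factor
  \<open>m\<close>, and only if its first letter is nonzero.\<close>

lemma modulus_dvd_functional_laplacian:
  assumes "v \<in> strings m n" "0 < n" "0 < m" "p \<in> stems m k" "k \<le> n"
  shows "int m ^ (Suc n - k) dvd functional m n r p (laplacian (de_Bruijn n m) v)"
proof -
  obtain c w where v: "v = c # w" using assms by (cases v) (auto simp: strings_def)
  have str: "w @ [a] \<in> strings m n" if "a < m" for a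
    using assms(1) that v by (auto simp: strings_def)
  have "functional m n r p (laplacian (de_Bruijn n m) v)
      = (\<Sum>a<m. word_coord m (w @ [a]) p - word_coord m r p)
        - int m * (word_coord m v p - word_coord m r p)"
    unfolding laplacian_de_Bruijn[OF assms(1,2)] functional_diff functional_sum functional_cmul
      functional_frag_of[OF assms(1)]
    using str by (simp add: v functional_frag_of)
  also have "\<dots> = - (if c = 0 then 0 else int m * coord m v p)"
    using sum_word_coord_snoc[OF assms(4,3)] by (simp add: sum_subtractf v algebra_simps)
  also have "int m ^ (Suc n - k) dvd \<dots>"
    using modulus_dvd_mult_coord[OF assms(4,5) _ assms(3,2), of v] assms(1)
    by (auto simp: strings_def)
  finally show ?thesis .
qed

lemma keys_frag_diff_subset:
  "Poly_Mapping.keys x \<subseteq> V \<Longrightarrow> Poly_Mapping.keys y \<subseteq> V \<Longrightarrow> Poly_Mapping.keys (x - y) \<subseteq> V"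
  using keys_diff[of x y] by blast

lemma keys_stem_frag:
  assumes "p \<in> stems m k" "k \<le> n" "0 < m"
  shows "Poly_Mapping.keys (stem_frag n p) \<subseteq> strings m n"
proof -
  obtain c w where p: "p = c # w" using assms by (cases p) (auto simp: stems_def)
  show ?thesis
    unfolding stem_frag_def using assms p
    by (intro keys_frag_diff_subset) (auto simp: stems_def strings_def)
qed

lemma keys_laplacian:
  assumes "v \<in> strings m n" "0 < n"
  shows "Poly_Mapping.keys (laplacian (de_Bruijn n m) v) \<subseteq> strings m n"
proof -
  obtain c w where v: "v = c # w" using assms by (cases v) (auto simp: strings_def)
  have "(\<Sum>a<m. frag_of (tl v @ [a])) \<in> carrier (free_Abelian_group (strings m n))"
    using assms v by (intro sum_closed_free_Abelian_group) (auto simp: strings_def)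
  then show ?thesis
    unfolding laplacian_de_Bruijn[OF assms] using assms keys_cmul
    by (intro keys_frag_diff_subset) (auto simp: keys_cmul_iff)
qed

section \<open>The relation subgroup described by congruences\<close>

definition relation_subgroup :: "nat \<Rightarrow> nat \<Rightarrow> nat list \<Rightarrow> (nat list \<Rightarrow>\<^sub>0 int) set" where
  "relation_subgroup m n r = generate (free_Abelian_group (strings m n))
     (insert (frag_of r) (laplacian (de_Bruijn n m) ` (strings m n - {r})))"

lemma relations_in_carrier:
  assumes "0 < n" "r \<in> strings m n"
  shows "insert (frag_of r) (laplacian (de_Bruijn n m) ` (strings m n - {r}))
    \<subseteq> carrier (free_Abelian_group (strings m n))"
  using keys_laplacian[OF _ assms(1)] assms(2) by auto

text \<open>The graph is Eulerian, so the omitted relation at \<open>r\<close> is implied by the others.\<close>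
lemma laplacian_subgroup_relation_subgroup:
  assumes "0 < m" "0 < n" "r \<in> strings m n"
  shows "laplacian_subgroup (relation_subgroup m n r) m n"
proof -
  interpret frag_subgroup "relation_subgroup m n r"
    unfolding relation_subgroup_def by (rule frag_subgroup_generate[OF relations_in_carrier[OF assms(2,3)]])
  have *: "laplacian (de_Bruijn n m) v \<in> relation_subgroup m n r" if "v \<in> strings m n" "v \<noteq> r" for v
    unfolding relation_subgroup_def using that by (intro generate.incl) auto
  have "laplacian (de_Bruijn n m) r = - (\<Sum>v\<in>strings m n - {r}. laplacian (de_Bruijn n m) v)"
    using sum_laplacian_de_Bruijn[OF assms(2), of m]
      sum.remove[OF finite_strings assms(3), of "laplacian (de_Bruijn n m)"]
    by (simp add: eq_neg_iff_add_eq_0)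
  also have "\<dots> \<in> relation_subgroup m n r"
    by (intro uminus_closed sum_closed *) auto
  finally have "laplacian (de_Bruijn n m) v \<in> relation_subgroup m n r" if "v \<in> strings m n" for v
    using *[OF that] by (cases "v = r") simp_all
  then show ?thesis
    using assms(1,2) by unfold_locales
qed

text \<open>The generators satisfy the congruences. Conversely, \<open>x\<close> is an integer
  combination of stem generators modulo the relations; duality recovers its coefficients up to the
  moduli, so the congruences make each coefficient a multiple of a number that kills its
  generator.\<close>

lemma relation_subgroup_eq:
  assumes "0 < m" "0 < n" "r \<in> strings m n"
  shows "relation_subgroup m n r = {x \<in> carrier (free_Abelian_group (strings m n)).
    \<forall>k\<in>{1..n}. \<forall>p\<in>stems m k. int m ^ (Suc n - k) dvd functional m n r p x}" (is "?N = ?K")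
proof
  interpret N: laplacian_subgroup ?N m n
    by (rule laplacian_subgroup_relation_subgroup[OF assms])
  let ?G = "free_Abelian_group (strings m n)"
  have K: "subgroup ?K ?G"
  proof
    show "x \<otimes>\<^bsub>?G\<^esub> y \<in> ?K" if "x \<in> ?K" "y \<in> ?K" for x y
      using that group.is_monoid[OF group_free_Abelian_group, THEN monoid.m_closed, of x "strings m n" y]
      by (auto simp: functional_add)
  qed (auto)
  have "frag_of r \<in> ?K" using assms by (simp add: functional_frag_of)
  moreover have "laplacian (de_Bruijn n m) v \<in> ?K" if "v \<in> strings m n" for v
    using modulus_dvd_functional_laplacian[OF that assms(2,1)] keys_laplacian[OF that assms(2)] by auto
  ultimately show "?N \<subseteq> ?K"
    unfolding relation_subgroup_def
    by (intro group.generate_subgroup_incl[OF group_free_Abelian_group _ K]) auto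
  show "?K \<subseteq> ?N"
  proof
    fix x assume x: "x \<in> ?K"
    define P where "P = (\<Union>k\<in>{1..n}. stems m k)"
    have finP: "finite P" by (simp add: P_def)
    \<comment> \<open>The elements that are integer combinations of stem generators modulo
      \<open>?N\<close>. \<open>H\<close> is a subgroup containing the Laplacians, the stem
      generators and \<open>r\<close>, so it contains the whole carrier.\<close>
    define H where "H = {x. \<exists>a. x - (\<Sum>p\<in>P. frag_cmul (a p) (stem_frag n p)) \<in> ?N}"
    have N_H: "y \<in> H" if "y \<in> ?N" for y
      unfolding H_def using that by (intro CollectI exI[of _ "\<lambda>_. 0"]) simp
    interpret H: laplacian_subgroup H m n
    proof
      fix y z assume "y \<in> H" "z \<in> H"
      then obtain a b where
        "y - (\<Sum>p\<in>P. frag_cmul (a p) (stem_frag n p)) \<in> ?N"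
        "z - (\<Sum>p\<in>P. frag_cmul (b p) (stem_frag n p)) \<in> ?N"
        unfolding H_def by blast
      from N.diff_closed[OF this]
      have "y - z - (\<Sum>p\<in>P. frag_cmul (a p - b p) (stem_frag n p)) \<in> ?N"
        by (simp add: frag_cmul_diff_distrib sum_subtractf algebra_simps)
      then show "y - z \<in> H" unfolding H_def by (intro CollectI exI[of _ "\<lambda>p. a p - b p"])
    qed (auto intro: N_H N.zero_closed N.laplacian_mem assms)
    have stem_H: "stem_frag n p \<in> H" if "k \<in> {1..n}" "p \<in> stems m k" for k p
    proof -
      have "(\<Sum>q\<in>P. frag_cmul (of_bool (q = p)) (stem_frag n q))
          = (\<Sum>q\<in>P. if q = p then stem_frag n p else 0)"
        by (intro sum.cong) auto
      also have "\<dots> = stem_frag n p" using that finP by (subst sum.delta) (auto simp: P_def)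
      finally show ?thesis
        unfolding H_def by (intro CollectI exI[of _ "\<lambda>q. of_bool (q = p)"]) (simp add: N.zero_closed)
    qed
    have r_H: "frag_of r \<in> H"
      by (rule N_H) (auto simp: relation_subgroup_def intro: generate.incl)
    have "x \<in> H"
      using H.carrier_subset[OF stem_H assms(3) r_H, where x = x] x by simp
    then obtain a where a: "x - (\<Sum>p\<in>P. frag_cmul (a p) (stem_frag n p)) \<in> ?N"
      unfolding H_def by blast
    \<comment> \<open>The functional of \<open>p\<close> sends the combination to \<open>a p\<close>
      and sends its difference from \<open>x\<close> to a multiple of the modulus, so the modulus
      divides \<open>a p\<close>.\<close>
    have "frag_cmul (a p) (stem_frag n p) \<in> ?N" if "p \<in> P" for p
    proof -
      obtain k where k: "k \<in> {1..n}" "p \<in> stems m k" using \<open>p \<in> P\<close> by (auto simp: P_def)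
      have "functional m n r p (stem_frag n q) = of_bool (q = p)" if "q \<in> P" for q
        using functional_stem_frag[OF k(2)] that by (auto simp: P_def)
      then have "functional m n r p (\<Sum>q\<in>P. frag_cmul (a q) (stem_frag n q))
          = (\<Sum>q\<in>P. if q = p then a p else 0)"
        unfolding functional_sum functional_cmul by (intro sum.cong) auto
      also have "\<dots> = a p" using \<open>p \<in> P\<close> finP by simp
      finally have "functional m n r p x
          = functional m n r p (x - (\<Sum>q\<in>P. frag_cmul (a q) (stem_frag n q))) + a p"
        by (simp add: functional_diff)
      moreover have "int m ^ (Suc n - k) dvd functional m n r p x"
        using x k by auto
      moreover have "int m ^ (Suc n - k) dvd functional m n r p (x - (\<Sum>q\<in>P. frag_cmul (a q) (stem_frag n q)))"
        using a \<open>?N \<subseteq> ?K\<close> k by blast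
      ultimately have "int m ^ (Suc n - k) dvd a p"
        by (simp add: dvd_add_right_iff)
      \<comment> \<open>Since \<open>k \<le> n\<close>, the exponent is \<open>Suc (n - k)\<close>,
        the one that annihilates a generator with \<open>n - k\<close> missing letters.\<close>
      then obtain b where b: "a p = b * int m ^ Suc (n - k)"
        using k by (auto simp: dvd_def mult.commute Suc_diff_le)
      have "frag_cmul (int m ^ Suc (n - k)) (stem_frag n p) \<in> ?N"
        using k by (intro N.order_stem_frag) (auto simp: stems_def strings_def)
      from N.cmul_closed[OF this, of b] show ?thesis by (simp add: b)
    qed
    then have "(\<Sum>p\<in>P. frag_cmul (a p) (stem_frag n p)) \<in> ?N"
      by (rule N.sum_closed)
    from N.add_closed[OF a this] show "x \<in> ?N" by simp
  qed
qed

text \<open>By duality the combination with coefficients \<open>t q\<close> takes these values; this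
  gives surjectivity.\<close>

lemma functional_prescribed:
  assumes "0 < m"
  obtains x where "x \<in> carrier (free_Abelian_group (strings m n))"
    "\<And>k p. k \<in> {1..n} \<Longrightarrow> p \<in> stems m k \<Longrightarrow> functional m n r p x = t p"
proof
  define P where "P = (\<Union>k\<in>{1..n}. stems m k)"
  have finP: "finite P" by (simp add: P_def)
  let ?x = "\<Sum>q\<in>P. frag_cmul (t q) (stem_frag n q)"
  show "?x \<in> carrier (free_Abelian_group (strings m n))"
  proof (rule sum_closed_free_Abelian_group)
    fix q assume "q \<in> P"
    then have "Poly_Mapping.keys (stem_frag n q) \<subseteq> strings m n"
      using keys_stem_frag assms by (fastforce simp: P_def)
    then show "frag_cmul (t q) (stem_frag n q) \<in> carrier (free_Abelian_group (strings m n))"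
      using keys_cmul[of "t q" "stem_frag n q"] by auto
  qed
  fix k p assume k: "k \<in> {1..n}" "p \<in> stems m k"
  have "functional m n r p (stem_frag n q) = of_bool (q = p)" if "q \<in> P" for q
    using functional_stem_frag[OF k(2)] that by (auto simp: P_def)
  then have "functional m n r p ?x = (\<Sum>q\<in>P. if q = p then t p else 0)"
    unfolding functional_sum functional_cmul by (intro sum.cong) auto
  also have "\<dots> = t p" using k finP by (subst sum.delta) (auto simp: P_def)
  finally show "functional m n r p ?x = t p" .
qed

section \<open>Powers of cyclic groups and the isomorphism\<close>

lemma carrier_group_power_integer_mod:
  assumes "0 < M"
  shows "carrier (group_power (integer_mod_group M) c) = {..<c} \<rightarrow>\<^sub>E {0..<int M}"
  using assms by (simp add: group_power_def carrier_integer_mod_group)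

lemma mult_group_power_integer_mod:
  "x \<otimes>\<^bsub>group_power (integer_mod_group M) c\<^esub> y = (\<lambda>j\<in>{..<c}. (x j + y j) mod int M)"
  by (simp add: group_power_def)

lemma one_group_power_integer_mod:
  "\<one>\<^bsub>group_power (integer_mod_group M) c\<^esub> = (\<lambda>j\<in>{..<c}. 0)"
  by (simp add: group_power_def)

lemma group_group_power [simp]: "group (group_power (integer_mod_group M) c)"
  by (simp add: group_power_def)

lemma restrict_eq_restrict_iff: "restrict f A = restrict g A \<longleftrightarrow> (\<forall>x\<in>A. f x = g x)"
  by (auto simp: fun_eq_iff)

theorem theorem5p1:
  fixes m n :: nat
  assumes "m \<ge> 2" and "n \<ge> 1"
  shows "\<forall>r \<in> verts (de_Bruijn n m).
           critical_group (de_Bruijn n m) r \<cong>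
             group_power (integer_mod_group (m ^ n)) (m - 2) \<times>\<times>
             sum_group {1..n - 1} (\<lambda>i.
               group_power (integer_mod_group (m ^ i)) (m ^ (n - 1 - i) * (m - 1)^2))"
proof
  fix r assume "r \<in> verts (de_Bruijn n m)"
  then have r: "r \<in> strings m n" by (simp add: de_Bruijn_def)
  have mn: "0 < m" "0 < n" using assms by auto
  define c where "c i = m ^ (n - 1 - i) * (m - 1)^2" for i
  define P where "P i = group_power (integer_mod_group (m ^ i)) (c i)" for i
  let ?A = "group_power (integer_mod_group (m ^ n)) (m - 2)"
  let ?B = "sum_group {1..n - 1} P"
  let ?G = "free_Abelian_group (strings m n)"
  have "\<forall>k. \<exists>f. bij_betw f {..<card (stems m k)} (stems m k)"
    using ex_bij_betw_nat_finite[OF finite_stems] by (simp add: atLeast0LessThan)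
  then obtain b where b: "\<And>k. bij_betw (b k) {..<card (stems m k)} (stems m k)"
    by metis
  have b_top: "bij_betw (b 1) {..<m - 2} (stems m 1)"
    using b[of 1] by (simp only: card_stems_one)
  \<comment> \<open>Stems of length \<open>Suc n - i\<close> give the factors of order
    \<open>m ^ i\<close>. The case \<open>i = n\<close>, length one, has its own count
    \<open>m - 2\<close> and forms the separate factor.\<close>
  have b_low: "bij_betw (b (Suc n - i)) {..<c i} (stems m (Suc n - i))" if "i \<in> {1..n - 1}" for i
  proof -
    have "Suc n - i = Suc (Suc (n - 1 - i))" using that by auto
    then have "card (stems m (Suc n - i)) = c i"
      by (simp only: card_stems_Suc_Suc c_def)
    then show ?thesis using b[of "Suc n - i"] by simp
  qed
  \<comment> \<open>The coordinate at the \<open>j\<close>-th stem of length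
    \<open>Suc n - i\<close>, reduced modulo \<open>m ^ i\<close>; \<open>h\<close> collects all of
    these.\<close>
  define \<phi> where "\<phi> i j x = functional m n r (b (Suc n - i) j) x mod int (m ^ i)" for i j x
  define h where "h x = (\<lambda>j\<in>{..<m - 2}. \<phi> n j x, \<lambda>i\<in>{1..n - 1}. \<lambda>j\<in>{..<c i}. \<phi> i j x)" for x
  have P_group: "group (P i)" for i by (simp add: P_def)
  have carrier_P: "carrier (P i) = {..<c i} \<rightarrow>\<^sub>E {0..<int (m ^ i)}" for i
    unfolding P_def using mn by (intro carrier_group_power_integer_mod) simp
  have carrier_A: "carrier ?A = {..<m - 2} \<rightarrow>\<^sub>E {0..<int (m ^ n)}"
    using mn by (intro carrier_group_power_integer_mod) simp
  \<comment> \<open>The index set is finite, so the direct sum has the full product as its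
    carrier.\<close>
  have carrier_B: "carrier ?B = (\<Pi>\<^sub>E i\<in>{1..n - 1}. {..<c i} \<rightarrow>\<^sub>E {0..<int (m ^ i)})"
    using P_group by (simp add: carrier_sum_group carrier_P)
  have \<phi>_range: "\<phi> i j x \<in> {0..<int (m ^ i)}" for i j x
    using mn by (simp add: \<phi>_def)
  have \<phi>_add: "\<phi> i j (x + y) = (\<phi> i j x + \<phi> i j y) mod int (m ^ i)" for i j x y
    by (simp add: \<phi>_def functional_add mod_add_eq)
  interpret h: group_hom ?G "?A \<times>\<times> ?B" h
  proof (intro group_hom.intro group_hom_axioms.intro homI)
    show "group (?A \<times>\<times> ?B)"
      by (intro DirProd_group) (simp_all add: P_group)
    fix x y
    show "h x \<in> carrier (?A \<times>\<times> ?B)"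
      unfolding carrier_DirProd carrier_A carrier_B h_def using \<phi>_range by auto
    show "h (x \<otimes>\<^bsub>?G\<^esub> y) = h x \<otimes>\<^bsub>?A \<times>\<times> ?B\<^esub> h y"
      by (auto simp: h_def \<phi>_add mult_group_power_integer_mod P_def intro!: restrict_ext)
  qed simp
  have onto: "h ` carrier ?G = carrier (?A \<times>\<times> ?B)"
  proof
    show "h ` carrier ?G \<subseteq> carrier (?A \<times>\<times> ?B)" using h.hom_closed by blast
    show "carrier (?A \<times>\<times> ?B) \<subseteq> h ` carrier ?G"
    proof
      fix z assume "z \<in> carrier (?A \<times>\<times> ?B)"
      then obtain s t where z: "z = (s, t)" and s: "s \<in> carrier ?A" and t: "t \<in> carrier ?B"
        by auto
      \<comment> \<open>The value demanded at each stem, found by inverting the enumeration of its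
        length: from \<open>s\<close> at length one, otherwise from the component \<open>i\<close>
        of \<open>t\<close> matching that length.\<close>
      define g where "g p = (if length p = 1 then s (inv_into {..<m - 2} (b 1) p)
        else let i = Suc n - length p in t i (inv_into {..<c i} (b (length p)) p))" for p
      obtain x where x: "x \<in> carrier ?G"
        "\<And>k p. k \<in> {1..n} \<Longrightarrow> p \<in> stems m k \<Longrightarrow> functional m n r p x = g p"
        using functional_prescribed[OF mn(1)] by blast
      have "\<phi> n j x = s j" if "j < m - 2" for j
      proof -
        have p: "b 1 j \<in> stems m 1" using bij_betwE[OF b_top] that by auto
        then have "functional m n r (b 1 j) x = g (b 1 j)" using x(2)[of 1] mn by auto
        also have "\<dots> = s j"
          using p that bij_betw_inv_into_left[OF b_top] by (simp add: g_def stems_def strings_def)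
        finally show ?thesis using s that unfolding carrier_A by (auto simp: \<phi>_def PiE_iff)
      qed
      moreover have "\<phi> i j x = t i j" if "i \<in> {1..n - 1}" "j < c i" for i j
      proof -
        have p: "b (Suc n - i) j \<in> stems m (Suc n - i)" using bij_betwE[OF b_low[OF that(1)]] that by auto
        then have len: "length (b (Suc n - i) j) = Suc n - i" by (simp add: stems_def strings_def)
        have i: "Suc n - i \<noteq> 1" "Suc n - (Suc n - i) = i" using that(1) by auto
        have "functional m n r (b (Suc n - i) j) x = g (b (Suc n - i) j)"
          using p that by (intro x(2)) auto
        also have "\<dots> = t i j"
          unfolding g_def Let_def len i(2)
          using i(1) that bij_betw_inv_into_left[OF b_low[OF that(1)]] by simp
        finally show ?thesis using t that unfolding carrier_B by (auto simp: \<phi>_def PiE_iff)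
      qed
      ultimately have "h x = z"
        using s t unfolding carrier_A carrier_B z h_def
        by (auto simp: fun_eq_iff PiE_iff extensional_def)
      then show "z \<in> h ` carrier ?G" using x(1) by blast
    qed
  qed
  have "kernel ?G (?A \<times>\<times> ?B) h = relation_subgroup m n r"
  proof -
    \<comment> \<open>Vanishing residues are divisibilities; the substitution
      \<open>k = Suc n - i\<close> turns the direct sum into the lengths from 2 to \<open>n\<close>,
      and the first factor supplies \<open>k = 1\<close>.\<close>
    have "h x = \<one>\<^bsub>?A \<times>\<times> ?B\<^esub> \<longleftrightarrow>
      (\<forall>k\<in>{1..n}. \<forall>p\<in>stems m k. int m ^ (Suc n - k) dvd functional m n r p x)" (is "_ \<longleftrightarrow> ?D") for x
    proof -
      have "h x = \<one>\<^bsub>?A \<times>\<times> ?B\<^esub> \<longleftrightarrow>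
        (\<forall>j\<in>{..<m - 2}. \<phi> n j x = 0) \<and> (\<forall>i\<in>{1..n - 1}. \<forall>j\<in>{..<c i}. \<phi> i j x = 0)"
        unfolding h_def one_DirProd one_group_power_integer_mod one_sum_group P_def
        by (simp add: restrict_eq_restrict_iff)
      also have "(\<forall>j\<in>{..<m - 2}. \<phi> n j x = 0) \<longleftrightarrow> (\<forall>p\<in>stems m 1. int m ^ n dvd functional m n r p x)"
        unfolding bij_betw_imp_surj_on[OF b_top, symmetric] by (simp add: \<phi>_def dvd_eq_mod_eq_0)
      also have "(\<forall>i\<in>{1..n - 1}. \<forall>j\<in>{..<c i}. \<phi> i j x = 0)
        \<longleftrightarrow> (\<forall>i\<in>{1..n - 1}. \<forall>p\<in>stems m (Suc n - i). int m ^ i dvd functional m n r p x)"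
      proof (intro ball_cong refl)
        fix i assume i: "i \<in> {1..n - 1}"
        show "(\<forall>j\<in>{..<c i}. \<phi> i j x = 0) \<longleftrightarrow> (\<forall>p\<in>stems m (Suc n - i). int m ^ i dvd functional m n r p x)"
          unfolding bij_betw_imp_surj_on[OF b_low[OF i], symmetric] by (simp add: \<phi>_def dvd_eq_mod_eq_0)
      qed
      also have "\<dots> \<longleftrightarrow> (\<forall>k\<in>{2..n}. \<forall>p\<in>stems m k. int m ^ (Suc n - k) dvd functional m n r p x)"
      proof -
        have eq: "{2..n} = (\<lambda>i. Suc n - i) ` {1..n - 1}"
        proof
          show "{2..n} \<subseteq> (\<lambda>i. Suc n - i) ` {1..n - 1}"
          proof
            fix k assume "k \<in> {2..n}"
            then show "k \<in> (\<lambda>i. Suc n - i) ` {1..n - 1}"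
              by (intro image_eqI[of _ _ "Suc n - k"]) auto
          qed
        qed auto
        have exponent: "int m ^ (Suc n - (Suc n - i)) = int m ^ i" if "i \<in> {1..n - 1}" for i
          using that by (intro arg_cong[where f = "(^) (int m)"]) auto
        show ?thesis
          unfolding eq ball_simps by (rule ball_cong) (simp_all only: exponent)
      qed
      also have "(\<forall>p\<in>stems m 1. int m ^ n dvd functional m n r p x) \<and>
        (\<forall>k\<in>{2..n}. \<forall>p\<in>stems m k. int m ^ (Suc n - k) dvd functional m n r p x) \<longleftrightarrow> ?D"
      proof -
        have "{1..n} = insert 1 {2..n}" using mn by auto
        then show ?thesis by simp
      qed
      finally show ?thesis .
    qed
    then show ?thesis
      unfolding kernel_def relation_subgroup_eq[OF mn r] by blast
  qed
  then have "?G Mod relation_subgroup m n r \<cong> ?A \<times>\<times> ?B"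
    using h.FactGroup_iso[OF onto] by simp
  moreover have "critical_group (de_Bruijn n m) r = ?G Mod relation_subgroup m n r"
    by (simp add: critical_group_def relation_subgroup_def de_Bruijn_def)
  moreover have "P = (\<lambda>i. group_power (integer_mod_group (m ^ i)) (m ^ (n - 1 - i) * (m - 1)^2))"
    by (rule ext) (simp only: P_def c_def)
  ultimately show "critical_group (de_Bruijn n m) r \<cong>
      ?A \<times>\<times> sum_group {1..n - 1} (\<lambda>i.
        group_power (integer_mod_group (m ^ i)) (m ^ (n - 1 - i) * (m - 1)^2))"
    by (simp only:)
qed

end
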